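(* Let $G$ be a finite simple graph with girth $g \in \{7,8,9,10\}$ and minimum degree $\delta \ge 2$. Then $F(G) \ge \delta + (\delta-2)(g-3)$.
   Context: The girth of a graph is the length of a shortest cycle in it. The forcing process on $G$: start with a set $S \subseteq V(G)$ of colored vertices, all other vertices non-colored; at each step, a colored vertex with exactly one non-colored neighbor forces that neighbor to become colored. $S$ is a forcing set if iterating this process eventually colors all of $V(G)$. The forcing number (zero forcing number) $F(G)$ is the minimum cardinality of a forcing set of $G$. *)

theory Defs
  imports "Graph_Theory.Arc_Walk" "HOL-Library.Extended_Nat"
begin

text \<open>
  A finite simple graph is a finite, loop-free, symmetric digraph without parallel arcs
  (locale \<^locale>\<open>graph\<close>): the edge uv is the pair of arcs (u,v) and (v,u).
\<close>

definition nbrs :: "('a, 'b) pre_digraph \<Rightarrow> 'a \<Rightarrow> 'a set" where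
  "nbrs G v = {w. v \<rightarrow>\<^bsub>G\<^esub> w}"

text \<open>In a simple graph the out-degree is the usual degree; see \<open>graph_out_degree_eq\<close> below.\<close>

definition min_degree :: "('a, 'b) pre_digraph \<Rightarrow> nat" where
  "min_degree G = Min (out_degree G ` verts G)"

text \<open>
  As a closed walk of arcs, an edge traversed back and forth satisfies
  \<^const>\<open>pre_digraph.cycle\<close>; it is not a cycle of the undirected graph. The length bound
  excludes exactly these walks.
\<close>

definition undirected_cycle :: "('a, 'b) pre_digraph \<Rightarrow> 'b list \<Rightarrow> bool" where
  "undirected_cycle G p \<longleftrightarrow> pre_digraph.cycle G p \<and> 3 \<le> length p"

text \<open>The girth of a forest is \<open>\<infinity>\<close>.\<close>

definition girth :: "('a, 'b) pre_digraph \<Rightarrow> enat" where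
  "girth G = (INF p \<in> {p. undirected_cycle G p}. enat (length p))"

text \<open>\<open>force_step G C D\<close>: one force by some \<open>v \<in> C\<close> turns the colored set \<open>C\<close> into \<open>D\<close>.\<close>

inductive force_step :: "('a, 'b) pre_digraph \<Rightarrow> 'a set \<Rightarrow> 'a set \<Rightarrow> bool"
  for G :: "('a, 'b) pre_digraph" where
  "\<lbrakk>v \<in> C; nbrs G v - C = {w}\<rbrakk> \<Longrightarrow> force_step G C (insert w C)"

definition forcing_set :: "('a, 'b) pre_digraph \<Rightarrow> 'a set \<Rightarrow> bool" where
  "forcing_set G S \<longleftrightarrow> S \<subseteq> verts G \<and> (force_step G)\<^sup>*\<^sup>* S (verts G)"

definition forcing_number :: "('a, 'b) pre_digraph \<Rightarrow> nat" where
  "forcing_number G = Min (card ` {S. forcing_set G S})"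

lemma (in graph) graph_out_degree_eq: "out_degree G v = card (nbrs G v)"
proof -
  have "nbrs G v = head G ` out_arcs G v"
    by (auto simp: nbrs_def arcs_ends_def arc_to_ends_def out_arcs_def)
  moreover have "inj_on (head G) (out_arcs G v)"
    using no_multi_arcs by (auto simp: inj_on_def arc_to_ends_def out_arcs_def)
  ultimately show ?thesis
    by (simp add: out_degree_def card_image)
qed

text \<open>The minimum in \<^const>\<open>forcing_number\<close> is over a finite, nonempty set of sizes.\<close>

lemma (in graph) finite_forcing_sets: "finite {S. forcing_set G S}"
  by (rule finite_subset[of _ "Pow (verts G)"]) (auto simp: forcing_set_def)

lemma forcing_set_verts: "forcing_set G (verts G)"
  by (simp add: forcing_set_def)

end

theory Submission
  imports Defs
begin

text \<open>
  Let \<open>A\<close> consist of the first \<open>t\<close> forcing vertices. After \<open>t\<close> forces the closed neighbourhood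
  \<open>N[A]\<close> is colored, so \<open>|N[A]| \<le> F(G) + t\<close>; if fewer than \<open>t\<close> forces occur, this holds
  for every \<open>A\<close> since then \<open>|V(G)| < F(G) + t\<close>. With \<open>t = g - 2\<close> it suffices to show
  \<open>|N[A]| \<ge> |A| (\<delta> - 1) + 2\<close> for every nonempty set \<open>A\<close> of at most \<open>g - 2\<close> vertices, whether or
  not it arises from a forcing process.

  Argue by induction on \<open>|A|\<close>. A vertex \<open>v\<close> whose closed neighbourhood meets \<open>N[A - v]\<close> at most
  twice can be removed. If there is none, then the edges meeting \<open>A\<close> contain a cycle; let \<open>C\<close> be a
  shortest such cycle and \<open>B\<close> its intersection with \<open>A\<close>. As \<open>C\<close> has length at least
  \<open>g \<ge> |A| + 2\<close> and no short ears, \<open>|N[B]| \<ge> |B| (\<delta> - 2) + |A| + 2\<close>. Every edge of \<open>C\<close> meets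
  \<open>A\<close>, so \<open>|B| \<ge> g / 2\<close>; as \<open>g \<le> 10\<close>, at most three vertices of \<open>A\<close> lie off \<open>C\<close>. Added
  one by one, they overlap the neighbourhood built so far at most three times on average.
\<close>

section \<open>Cycles as vertex lists\<close>

definition vertex_cycle :: "('a \<Rightarrow> 'a \<Rightarrow> bool) \<Rightarrow> 'a list \<Rightarrow> bool" where
  "vertex_cycle E xs \<longleftrightarrow>
    3 \<le> length xs \<and> distinct xs \<and> successively E xs \<and> E (last xs) (hd xs)"

lemma vertex_cycle_mono:
  assumes "vertex_cycle E xs" "\<And>x y. E x y \<Longrightarrow> F x y"
  shows "vertex_cycle F xs"
  using assms by (auto simp: vertex_cycle_def elim: successively_mono)

lemma vertex_cycle_nth:
  assumes "vertex_cycle E xs" "i < length xs"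
  shows "E (xs ! i) (xs ! (Suc i mod length xs))"
proof (cases "Suc i < length xs")
  case True
  then show ?thesis using assms by (auto simp: vertex_cycle_def successively_nth)
next
  case False
  then have "Suc i = length xs" using assms(2) by simp
  moreover have "xs \<noteq> []" using assms(2) by auto
  ultimately have "xs ! i = last xs" "xs ! (Suc i mod length xs) = hd xs"
    by (auto simp: last_conv_nth hd_conv_nth simp flip: \<open>Suc i = length xs\<close>)
  then show ?thesis using assms by (simp add: vertex_cycle_def)
qed

text \<open>A longest path in \<open>W\<close> cannot be extended at its first vertex, so a
  neighbour of that vertex other than its successor lies on the path and closes a cycle.\<close>

lemma exists_vertex_cycle:
  assumes fin: "finite W" and "W \<noteq> {}"
    and sym: "\<And>x y. E x y \<Longrightarrow> E y x" and irrefl: "\<And>x. \<not> E x x"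
    and two: "\<And>w u. w \<in> W \<Longrightarrow> \<exists>w'\<in>W. E w w' \<and> w' \<noteq> u"
  shows "\<exists>xs. vertex_cycle E xs"
proof -
  let ?path = "\<lambda>xs. xs \<noteq> [] \<and> distinct xs \<and> set xs \<subseteq> W \<and> successively E xs"
  obtain w where "w \<in> W" using \<open>W \<noteq> {}\<close> by blast
  then have "?path [w]" by simp
  moreover have "\<forall>xs. ?path xs \<longrightarrow> length xs < Suc (card W)"
    using fin by (metis card_mono distinct_card le_imp_less_Suc)
  ultimately have "\<exists>xs. ?path xs \<and> (\<forall>ys. ?path ys \<longrightarrow> length ys \<le> length xs)"
    by (rule ex_has_greatest_nat)
  then obtain xs where xs: "?path xs" and max: "\<And>ys. ?path ys \<Longrightarrow> length ys \<le> length xs"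
    by blast
  \<comment> \<open>The neighbour to avoid is the second vertex of the path. A one-vertex path has
    none, and there \<open>hd xs\<close> is a harmless default.\<close>
  define u where "u = (if length xs = 1 then hd xs else xs ! 1)"
  have "hd xs \<in> W" using xs by auto
  then obtain w' where w': "w' \<in> W" "E (hd xs) w'" "w' \<noteq> u" using two by blast
  have "w' \<in> set xs"
  proof (rule ccontr)
    assume "w' \<notin> set xs"
    then have "?path (w' # xs)" using xs w' sym by (auto simp: successively_Cons)
    then show False using max by fastforce
  qed
  then obtain k where k: "k < length xs" "xs ! k = w'" by (auto simp: in_set_conv_nth)
  have hd: "hd xs = xs ! 0" using xs by (simp add: hd_conv_nth)
  have "k \<noteq> 0" using k hd w'(2) irrefl by metis
  moreover have "k \<noteq> 1" using k w'(3) by (auto simp: u_def)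
  ultimately have "2 \<le> k" by simp
  let ?c = "take (Suc k) xs"
  have "successively E ?c"
    using xs k by (auto simp: successively_conv_nth)
  moreover have "last ?c = w'"
    using k by (simp add: take_Suc_conv_app_nth)
  moreover have "hd ?c = hd xs"
    by (simp add: hd_take)
  ultimately have "vertex_cycle E ?c"
    using xs k \<open>2 \<le> k\<close> w' sym by (auto simp: vertex_cycle_def)
  then show ?thesis by blast
qed

lemma nth_split2:
  assumes "i < j" "j < length xs"
  obtains as bs cs where "xs = as @ xs ! i # bs @ xs ! j # cs"
    "length as = i" "length bs = j - Suc i" "length cs = length xs - Suc j"
proof -
  let ?bs = "take (j - Suc i) (drop (Suc i) xs)"
  have "xs = take i xs @ xs ! i # drop (Suc i) xs"
    using assms by (simp add: id_take_nth_drop[symmetric])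
  moreover have "drop (Suc i) xs = ?bs @ xs ! j # drop (Suc j) xs"
    using assms by (subst id_take_nth_drop[of "j - Suc i"]) auto
  ultimately show ?thesis
    using assms by (intro that[of "take i xs" ?bs "drop (Suc j) xs"]) auto
qed

text \<open>The ear closes a cycle with each of the two arcs of \<open>xs\<close> between its ends,
  and neither cycle is shorter than \<open>xs\<close>. By \<open>proper\<close> the ear is not
  itself an edge of \<open>xs\<close>, so both closed lists have at least three vertices.\<close>

lemma shortest_cycle_ear:
  assumes cyc: "vertex_cycle E xs"
    and shortest: "\<And>ys. vertex_cycle E ys \<Longrightarrow> length xs \<le> length ys"
    and sym: "\<And>x y. E x y \<Longrightarrow> E y x"
    and ij: "i < j" "j < length xs"
    and ear: "successively E (xs ! i # ps @ [xs ! j])" "distinct ps" "set ps \<inter> set xs = {}"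
    and proper: "ps \<noteq> [] \<or> (Suc i < j \<and> Suc j < i + length xs)"
  shows "j - i \<le> Suc (length ps)" "length xs \<le> (j - i) + Suc (length ps)"
proof -
  obtain as bs cs where xs: "xs = as @ xs ! i # bs @ xs ! j # cs"
    and len: "length as = i" "length bs = j - Suc i" "length cs = length xs - Suc j"
    using nth_split2[OF ij] .
  define u v where "u = xs ! i" and "v = xs ! j"
  have xs': "xs = as @ u # bs @ v # cs" using xs by (simp add: u_def v_def)
  have ear': "successively E (u # ps @ [v])" using ear(1) by (simp add: u_def v_def)
  have d: "distinct (as @ u # bs @ v # cs)" and s: "successively E (as @ u # bs @ v # cs)"
    and cl: "E (last (as @ u # bs @ v # cs)) (hd (as @ u # bs @ v # cs))"
    using cyc unfolding vertex_cycle_def xs' by auto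
  have disj: "set ps \<inter> set (as @ u # bs @ v # cs) = {}" using ear(3) xs' by simp
  have "successively E (rev (u # ps @ [v]))"
    unfolding successively_rev using ear' by (rule successively_mono) (use sym in auto)
  then have earr: "successively E (v # rev ps @ [u])" by simp
  \<comment> \<open>\<open>?c1\<close> keeps the inner arc \<open>bs\<close> and returns along the
    ear; \<open>?c2\<close> replaces \<open>bs\<close> by the ear.\<close>
  let ?c1 = "u # bs @ v # rev ps" and ?c2 = "as @ u # ps @ v # cs"
  have "vertex_cycle E ?c1"
    unfolding vertex_cycle_def
  proof (intro conjI)
    show "3 \<le> length ?c1" using proper len ij by (cases ps) auto
    show "distinct ?c1" using d disj ear(2) by auto
    show "successively E ?c1"
      using s earr by (auto simp: successively_append_iff successively_Cons hd_append split: if_splits)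
    show "E (last ?c1) (hd ?c1)"
      using earr by (cases ps) (auto simp: successively_append_iff successively_Cons)
  qed
  from shortest[OF this] show "length xs \<le> (j - i) + Suc (length ps)"
    using len ij by simp
  have "vertex_cycle E ?c2"
    unfolding vertex_cycle_def
  proof (intro conjI)
    show "3 \<le> length ?c2" using proper len ij by (cases ps) auto
    show "distinct ?c2" using d disj ear(2) by auto
    show "successively E ?c2"
      using s ear' by (auto simp: successively_append_iff successively_Cons hd_append split: if_splits)
    show "E (last ?c2) (hd ?c2)"
      using cl by (cases as; cases cs) auto
  qed
  from shortest[OF this] show "j - i \<le> Suc (length ps)"
    using len ij by simp
qed


section \<open>Closed neighbourhoods in graphs of given girth\<close>

locale girth_graph =
  fixes E :: "'a \<Rightarrow> 'a \<Rightarrow> bool" and V :: "'a set" and d g :: nat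
  assumes finite_V: "finite V"
    and sym: "E x y \<Longrightarrow> E y x"
    and irrefl: "\<not> E x x"
    and E_in_V: "E x y \<Longrightarrow> y \<in> V"
    and degree: "v \<in> V \<Longrightarrow> d \<le> card {w. E v w}"
    and girth: "vertex_cycle E xs \<Longrightarrow> g \<le> length xs"
begin

definition closed_nbhd :: "'a set \<Rightarrow> 'a set" where
  "closed_nbhd B = B \<union> {w. \<exists>v\<in>B. E v w}"

lemma closed_nbhd_subset_V: "B \<subseteq> V \<Longrightarrow> closed_nbhd B \<subseteq> V"
  using E_in_V by (auto simp: closed_nbhd_def)

lemma finite_closed_nbhd: "B \<subseteq> V \<Longrightarrow> finite (closed_nbhd B)"
  using closed_nbhd_subset_V finite_V finite_subset by blast

lemma finite_nbrs: "finite {w. E v w}"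
  using finite_V by (rule rev_finite_subset) (auto dest: E_in_V)

lemma closed_nbhd_insert: "closed_nbhd (insert v B) = closed_nbhd {v} \<union> closed_nbhd B"
  by (auto simp: closed_nbhd_def)

lemma no_triangle:
  assumes "4 \<le> g" "E x y" "E y z" "E z x"
  shows False
proof -
  have "vertex_cycle E [x, y, z]"
    using assms irrefl by (auto simp: vertex_cycle_def)
  from girth[OF this] show False using assms(1) by simp
qed

lemma no_square:
  assumes "5 \<le> g" "E x y" "E y z" "E z w" "E w x" "x \<noteq> z" "y \<noteq> w"
  shows False
proof -
  have "vertex_cycle E [x, y, z, w]"
    using assms irrefl by (auto simp: vertex_cycle_def)
  from girth[OF this] show False using assms(1) by simp
qed

lemma card_closed_nbhd_singleton:
  assumes "v \<in> V" shows "d + 1 \<le> card (closed_nbhd {v})"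
proof -
  have "closed_nbhd {v} = insert v {w. E v w}" by (auto simp: closed_nbhd_def)
  then show ?thesis using degree[OF assms] irrefl finite_nbrs by simp
qed

text \<open>Inclusion-exclusion. An overlap of \<open>k = 2\<close> yields the gain
  \<open>d - 1\<close> per vertex that the final bound asks for.\<close>

lemma card_closed_nbhd_insert:
  assumes "v \<in> V" "B \<subseteq> V" "card (closed_nbhd {v} \<inter> closed_nbhd B) \<le> k"
  shows "card (closed_nbhd B) + d + 1 \<le> card (closed_nbhd (insert v B)) + k"
proof -
  have "card (closed_nbhd {v}) + card (closed_nbhd B)
      = card (closed_nbhd (insert v B)) + card (closed_nbhd {v} \<inter> closed_nbhd B)"
    unfolding closed_nbhd_insert[of v B]
    by (rule card_Un_Int) (use assms finite_closed_nbhd in auto)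
  then show ?thesis using card_closed_nbhd_singleton[OF assms(1)] assms(3) by simp
qed

text \<open>Two such neighbours would close a triangle or a four-cycle through \<open>v\<close> and
  \<open>w\<close>.\<close>

lemma card_nbrs_Int_closed_nbhd_singleton:
  assumes "5 \<le> g" "v \<noteq> w"
  shows "card ({y. E v y} \<inter> closed_nbhd {w}) \<le> 1"
proof -
  have "y = z" if "y \<in> {y. E v y} \<inter> closed_nbhd {w}" "z \<in> {y. E v y} \<inter> closed_nbhd {w}" for y z
  proof (rule ccontr)
    assume "y \<noteq> z"
    with that no_square[OF assms(1), of v y w z] no_triangle[of v w z] no_triangle[of v w y] assms
    show False by (auto simp: closed_nbhd_def dest: sym)
  qed
  then show ?thesis by (simp add: card_le_Suc0_iff_eq finite_nbrs)
qed

lemma card_Int_closed_nbhd_le: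
  assumes "v \<notin> B"
  shows "card (closed_nbhd {v} \<inter> closed_nbhd B) \<le> Suc (card ({y. E v y} \<inter> closed_nbhd B))"
proof -
  have "closed_nbhd {v} \<inter> closed_nbhd B \<subseteq> insert v ({y. E v y} \<inter> closed_nbhd B)"
    by (auto simp: closed_nbhd_def)
  then have "card (closed_nbhd {v} \<inter> closed_nbhd B) \<le> card (insert v ({y. E v y} \<inter> closed_nbhd B))"
    by (rule card_mono[rotated]) (simp add: finite_nbrs)
  also have "\<dots> \<le> Suc (card ({y. E v y} \<inter> closed_nbhd B))"
    by (rule card_insert_le_m1) auto
  finally show ?thesis .
qed

lemma card_Int_closed_nbhd_insert:
  "card (S \<inter> closed_nbhd (insert w B)) \<le> card (S \<inter> closed_nbhd B) + card (S \<inter> closed_nbhd {w})"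
proof -
  have "S \<inter> closed_nbhd (insert w B) = (S \<inter> closed_nbhd B) \<union> (S \<inter> closed_nbhd {w})"
    by (auto simp: closed_nbhd_def)
  then show ?thesis by (simp add: card_Un_le)
qed

text \<open>Edges meeting \<open>A\<close>, not only edges within \<open>A\<close>: neighbourhoods
  that overlap in a vertex outside \<open>A\<close> must be able to close a cycle.\<close>

definition edge_at :: "'a set \<Rightarrow> 'a \<Rightarrow> 'a \<Rightarrow> bool" where
  "edge_at A x y \<longleftrightarrow> E x y \<and> (x \<in> A \<or> y \<in> A)"

lemma edge_at_sym: "edge_at A x y \<Longrightarrow> edge_at A y x"
  using sym by (auto simp: edge_at_def)

end

section \<open>A shortest cycle among the edges meeting \<open>A\<close>\<close>

locale shortest_cycle_at = girth_graph +
  fixes A :: "'a set" and xs :: "'a list"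
  assumes A_subset_V: "A \<subseteq> V"
    and cycle: "vertex_cycle (edge_at A) xs"
    and shortest: "vertex_cycle (edge_at A) ys \<Longrightarrow> length xs \<le> length ys"
    and girth_ge_7: "7 \<le> g"
begin

lemma length_ge: "g \<le> length xs"
  using cycle by (intro girth, rule vertex_cycle_mono) (auto simp: edge_at_def)

lemma distinct_xs: "distinct xs"
  using cycle by (simp add: vertex_cycle_def)

text \<open>\<open>shortest_cycle_ear\<close> made symmetric in the two positions: the ear is
  reversed if \<open>j < i\<close>, and integers allow the absolute difference.\<close>

lemma ear:
  assumes "i < length xs" "j < length xs" "i \<noteq> j"
    and "successively (edge_at A) (xs ! i # ps @ [xs ! j])" "distinct ps" "set ps \<inter> set xs = {}"
    and "ps \<noteq> []"
  shows "\<bar>int i - int j\<bar> \<le> int (length ps) + 1"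
    "int (length xs) \<le> \<bar>int i - int j\<bar> + int (length ps) + 1"
proof -
  have "\<bar>int i - int j\<bar> \<le> int (length ps) + 1 \<and>
    int (length xs) \<le> \<bar>int i - int j\<bar> + int (length ps) + 1"
  proof (cases "i < j")
    case True
    show ?thesis
      using shortest_cycle_ear[OF cycle shortest edge_at_sym True assms(2,4,5,6)] assms(7) True
      by auto
  next
    case False
    then have "j < i" using assms(3) by simp
    have "successively (edge_at A) (rev (xs ! i # ps @ [xs ! j]))"
      unfolding successively_rev using assms(4) by (rule successively_mono) (use edge_at_sym in auto)
    then have "successively (edge_at A) (xs ! j # rev ps @ [xs ! i])" by simp
    from shortest_cycle_ear[OF cycle shortest edge_at_sym \<open>j < i\<close> assms(1) this] show ?thesis
      using assms(5-7) \<open>j < i\<close> by auto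
  qed
  then show "\<bar>int i - int j\<bar> \<le> int (length ps) + 1"
    "int (length xs) \<le> \<bar>int i - int j\<bar> + int (length ps) + 1" by auto
qed

lemma no_chord:
  assumes "i < j" "j < length xs" "edge_at A (xs ! i) (xs ! j)"
  shows "j = Suc i \<or> i = 0 \<and> Suc j = length xs"
proof (rule ccontr)
  assume *: "\<not> ?thesis"
  have "j - i \<le> Suc (length ([] :: 'a list))"
    by (rule shortest_cycle_ear(1)[OF cycle shortest edge_at_sym assms(1,2)]) (use assms * in auto)
  moreover have "j \<noteq> Suc i" using * by simp
  ultimately show False using assms(1) by simp
qed

text \<open>All edges at \<open>v\<close> meet \<open>A\<close>, so an edge to a vertex of the cycle
  other than the successor or predecessor of \<open>v\<close> would be a chord.\<close>

lemma card_nbrs_on_cycle: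
  assumes "v \<in> A" "v \<in> set xs"
  shows "card ({w. E v w} \<inter> set xs) \<le> 2"
proof -
  obtain i where i: "i < length xs" "v = xs ! i" using assms(2) by (auto simp: in_set_conv_nth)
  \<comment> \<open>Cyclic successor and predecessor; adding \<open>length xs\<close> first keeps
    the subtraction from truncating at \<open>i = 0\<close>.\<close>
  have "{w. E v w} \<inter> set xs \<subseteq> {xs ! (Suc i mod length xs), xs ! ((i + length xs - 1) mod length xs)}"
  proof
    fix w assume "w \<in> {w. E v w} \<inter> set xs"
    then obtain j where j: "j < length xs" "w = xs ! j" "E v w" by (auto simp: in_set_conv_nth)
    then have e: "edge_at A (xs ! i) (xs ! j)" using assms i by (simp add: edge_at_def)
    have "i \<noteq> j" using j i irrefl by auto
    have "j = Suc i mod length xs \<or> j = (i + length xs - 1) mod length xs"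
    proof (cases "i < j")
      case True
      from no_chord[OF this j(1) e] show ?thesis using i j by auto
    next
      case False
      then have "j < i" using \<open>i \<noteq> j\<close> by simp
      from no_chord[OF this i(1) edge_at_sym[OF e]] show ?thesis
        using i j by auto
    qed
    then show "w \<in> {xs ! (Suc i mod length xs), xs ! ((i + length xs - 1) mod length xs)}"
      using j by auto
  qed
  from card_mono[OF _ this] show ?thesis
    by (auto intro: order_trans simp: card_insert_if split: if_splits)
qed

text \<open>\<open>y\<close> would be an ear with one inner vertex, which bounds the cycle length by
  4.\<close>

lemma no_common_nbr_off_cycle:
  assumes "v \<in> A" "v \<in> set xs" "w \<in> A" "w \<in> set xs" "v \<noteq> w" "E v y" "E w y"
  shows "y \<in> set xs"
proof (rule ccontr)
  assume y: "y \<notin> set xs"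
  obtain i j where ij: "i < length xs" "v = xs ! i" "j < length xs" "w = xs ! j"
    using assms(2,4) by (auto simp: in_set_conv_nth)
  have "i \<noteq> j" using ij assms by auto
  have "successively (edge_at A) (xs ! i # [y] @ [xs ! j])"
    using assms ij sym by (auto simp: edge_at_def)
  from ear[OF ij(1,3) \<open>i \<noteq> j\<close> this] show False
    using y length_ge girth_ge_7 by auto
qed

lemma edge_at_next:
  "i < length xs \<Longrightarrow> edge_at A (xs ! i) (xs ! (Suc i mod length xs))"
  by (rule vertex_cycle_nth[OF cycle])

text \<open>Each vertex of \<open>A\<close> on the cycle has at least \<open>d - 2\<close>
  neighbours off it, these sets are pairwise disjoint, and the cycle itself lies in the
  neighbourhood.\<close>

lemma card_closed_nbhd_cycle:
  "card (A \<inter> set xs) * (d - 2) + length xs \<le> card (closed_nbhd (A \<inter> set xs))"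
proof -
  let ?B = "A \<inter> set xs" and ?P = "\<lambda>v. {w. E v w} - set xs"
  \<comment> \<open>A cycle vertex outside \<open>A\<close> has its successor in \<open>A\<close>,
    since every cycle edge meets \<open>A\<close>.\<close>
  have xs_sub: "set xs \<subseteq> closed_nbhd ?B"
  proof
    fix x assume "x \<in> set xs"
    then obtain i where i: "i < length xs" "x = xs ! i" by (auto simp: in_set_conv_nth)
    have "xs ! (Suc i mod length xs) \<in> set xs" using i(1) by (intro nth_mem mod_less_divisor) auto
    then show "x \<in> closed_nbhd ?B"
      using edge_at_next[OF i(1)] i sym \<open>x \<in> set xs\<close> by (auto simp: closed_nbhd_def edge_at_def)
  qed
  have "card ?B * (d - 2) \<le> (\<Sum>v\<in>?B. card (?P v))"
  proof -
    have "d - 2 \<le> card (?P v)" if v: "v \<in> ?B" for v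
    proof -
      have "card {w. E v w} = card (?P v) + card ({w. E v w} \<inter> set xs)"
        by (subst card_Un_disjoint[symmetric]) (auto simp: finite_nbrs intro: arg_cong[where f=card])
      then show ?thesis
        using degree[of v] card_nbrs_on_cycle[of v] v A_subset_V by fastforce
    qed
    then show ?thesis using sum_bounded_below[of ?B "d - 2" "\<lambda>v. card (?P v)"] by simp
  qed
  also have "\<dots> = card (\<Union>v\<in>?B. ?P v)"
    by (rule card_UN_disjoint[symmetric])
      (use no_common_nbr_off_cycle finite_nbrs in auto)
  finally have "card ?B * (d - 2) + length xs \<le> card (\<Union>v\<in>?B. ?P v) + card (set xs)"
    using distinct_card[OF distinct_xs] by simp
  also have "\<dots> = card ((\<Union>v\<in>?B. ?P v) \<union> set xs)"
    by (rule card_Un_disjoint[symmetric]) (auto simp: finite_nbrs)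
  also have "\<dots> \<le> card (closed_nbhd ?B)"
    using xs_sub A_subset_V
    by (intro card_mono finite_closed_nbhd) (auto simp: closed_nbhd_def)
  finally show ?thesis .
qed

text \<open>No two consecutive cycle vertices avoid \<open>A\<close>, so the successor map injects
  the positions outside \<open>A\<close> into those in \<open>A\<close>.\<close>

lemma length_le_double: "length xs \<le> 2 * card (A \<inter> set xs)"
proof -
  let ?l = "length xs"
  let ?I = "{i. i < ?l \<and> xs ! i \<notin> A}" and ?J = "{i. i < ?l \<and> xs ! i \<in> A}"
  have "card ?I \<le> card ?J"
  proof (rule card_inj_on_le[of "\<lambda>i. Suc i mod ?l"])
    show "inj_on (\<lambda>i. Suc i mod ?l) ?I"
      by (auto simp: inj_on_def mod_Suc split: if_splits)
    show "(\<lambda>i. Suc i mod ?l) ` ?I \<subseteq> ?J"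
      using edge_at_next by (auto simp: edge_at_def intro!: mod_less_divisor)
  qed auto
  moreover have "card ?I + card ?J = ?l"
    by (subst card_Un_disjoint[symmetric]) (auto intro: trans[OF arg_cong[where f=card and y="{..<?l}"]])
  moreover have "card ?J = card (A \<inter> set xs)"
    by (rule bij_betw_same_card[of "(!) xs"])
      (use distinct_xs in \<open>auto simp: bij_betw_def inj_on_def nth_eq_iff_index_eq in_set_conv_nth\<close>)
  ultimately show ?thesis by simp
qed

section \<open>Overlap of a vertex off the cycle with the neighbourhood of the cycle\<close>

text \<open>\<open>foot y i p\<close>: a neighbour \<open>y\<close> of a vertex \<open>v\<close> off the cycle continues to a path of
  length \<open>p\<close> from \<open>v\<close> to the \<open>i\<close>-th vertex of the cycle.\<close>

definition foot :: "'a \<Rightarrow> nat \<Rightarrow> nat \<Rightarrow> bool" where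
  "foot y i p \<longleftrightarrow> i < length xs \<and>
    (y = xs ! i \<and> p = 1 \<or> y \<notin> set xs \<and> xs ! i \<in> A \<and> E y (xs ! i) \<and> p = 2)"

lemma foot_exists:
  assumes "y \<in> closed_nbhd (A \<inter> set xs)"
  obtains i p where "foot y i p"
proof (cases "y \<in> set xs")
  case True
  then show ?thesis using that[of _ 1] by (auto simp: foot_def in_set_conv_nth)
next
  case False
  then obtain i where "i < length xs" "xs ! i \<in> A" "E y (xs ! i)"
    using assms sym by (auto simp: closed_nbhd_def in_set_conv_nth)
  then show ?thesis using that[of i 2] False by (auto simp: foot_def)
qed

text \<open>The path stays within the edges meeting \<open>A\<close>: \<open>v\<close> is in
  \<open>A\<close>, and for \<open>p = 2\<close> so is its end on the cycle.\<close>

lemma foot_path: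
  assumes "foot y i p" "E v y" "v \<in> A" "v \<notin> set xs"
  obtains qs where "length qs = p - 1" "set qs \<subseteq> {y} - set xs" "distinct qs"
    "successively (edge_at A) (xs ! i # qs @ [v])"
  using assms sym that[of "[]"] that[of "[y]"] by (auto simp: foot_def edge_at_def)

text \<open>The two paths joined at \<open>v\<close> form an ear with \<open>p + q - 1\<close> inner
  vertices.\<close>

lemma feet_distance:
  assumes v: "v \<in> A" "v \<notin> set xs" and "E v y" "E v z" "y \<noteq> z" "foot y i p" "foot z j q"
  shows "\<bar>int i - int j\<bar> \<le> int p + int q"
    "int (length xs) \<le> \<bar>int i - int j\<bar> + int p + int q"
proof -
  \<comment> \<open>Equal feet would give a triangle or a four-cycle through \<open>v\<close>,
    \<open>y\<close> and \<open>z\<close>.\<close>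
  have "i \<noteq> j"
  proof
    assume "i = j"
    then have "v \<noteq> xs ! i" using assms(2,6) by (auto simp: foot_def)
    then show False
      using assms \<open>i = j\<close> no_square[of v y "xs ! i" z] no_triangle[of v y z] girth_ge_7 sym
      unfolding foot_def by auto
  qed
  obtain qs where qs: "length qs = p - 1" "set qs \<subseteq> {y} - set xs" "distinct qs"
    "successively (edge_at A) (xs ! i # qs @ [v])"
    using foot_path[OF assms(6,3) v] .
  obtain rs where rs: "length rs = q - 1" "set rs \<subseteq> {z} - set xs" "distinct rs"
    "successively (edge_at A) (xs ! j # rs @ [v])"
    using foot_path[OF assms(7,4) v] .
  have "successively (edge_at A) (rev (xs ! j # rs @ [v]))"
    unfolding successively_rev using rs(4) by (rule successively_mono) (use edge_at_sym in auto)
  then have "successively (edge_at A) (xs ! i # (qs @ v # rev rs) @ [xs ! j])"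
    using qs(4) by (auto simp: successively_append_iff successively_Cons hd_append split: if_splits)
  moreover have "distinct (qs @ v # rev rs)" "set (qs @ v # rev rs) \<inter> set xs = {}"
    using qs(2,3) rs(2,3) assms irrefl by auto
  moreover have "i < length xs" "j < length xs" "1 \<le> p" "1 \<le> q"
    using assms by (auto simp: foot_def)
  ultimately show "\<bar>int i - int j\<bar> \<le> int p + int q"
    "int (length xs) \<le> \<bar>int i - int j\<bar> + int p + int q"
    using ear[of i j "qs @ v # rev rs"] \<open>i \<noteq> j\<close> qs(1) rs(1) by auto
qed

lemma foot_le_2: "foot y i p \<Longrightarrow> 1 \<le> p \<and> p \<le> 2"
  by (auto simp: foot_def)

text \<open>Adding the two inequalities of \<open>feet_distance\<close> gives
  \<open>length xs \<le> 2 * (p + q)\<close>, hence at most 8.\<close>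

lemma card_nbrs_Int_closed_nbhd_cycle:
  assumes v: "v \<in> A" "v \<notin> set xs" and "9 \<le> length xs"
  shows "card ({y. E v y} \<inter> closed_nbhd (A \<inter> set xs)) \<le> 1"
proof -
  have "y = z" if yz: "E v y" "E v z" "y \<in> closed_nbhd (A \<inter> set xs)" "z \<in> closed_nbhd (A \<inter> set xs)" for y z
  proof (rule ccontr)
    assume "y \<noteq> z"
    obtain i p where f1: "foot y i p" using foot_exists[OF yz(3)] .
    obtain j q where f2: "foot z j q" using foot_exists[OF yz(4)] .
    from feet_distance[OF v yz(1,2) \<open>y \<noteq> z\<close> f1 f2] foot_le_2[OF f1] foot_le_2[OF f2]
    show False using assms(3) by linarith
  qed
  then show ?thesis by (simp add: card_le_Suc0_iff_eq finite_nbrs)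
qed

lemma card_closed_nbhd_Int_cycle:
  assumes v: "v \<in> A" "v \<notin> set xs"
  shows "card (closed_nbhd {v} \<inter> closed_nbhd (A \<inter> set xs)) \<le> 2"
proof (rule ccontr)
  let ?C = "closed_nbhd (A \<inter> set xs)"
  let ?S = "closed_nbhd {v} \<inter> ?C"
  have l: "7 \<le> length xs" using length_ge girth_ge_7 by simp
  \<comment> \<open>Here \<open>7 \<le> length xs \<le> 2 * (p + q)\<close> forces
    \<open>p + q = 4\<close>.\<close>
  have two: "p = 2 \<and> q = 2"
    if "E v y" "E v z" "y \<noteq> z" "foot y i p" "foot z j q" for y z i j p q
    using feet_distance[OF v that] foot_le_2[OF that(4)] foot_le_2[OF that(5)] l by linarith
  assume "\<not> card ?S \<le> 2"
  then have "3 \<le> card ?S" by simp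
  then obtain T where "T \<subseteq> ?S" "card T = 3" by (rule obtain_subset_with_card_n)
  then obtain a b c where abc: "a \<in> ?S" "b \<in> ?S" "c \<in> ?S" "a \<noteq> b" "a \<noteq> c" "b \<noteq> c"
    by (auto simp: card_3_iff)
  show False
  proof (cases "v \<in> {a, b, c}")
    \<comment> \<open>If \<open>v\<close> itself is in the overlap, it is adjacent to a cycle vertex
      \<open>u\<close>, a foot at distance 1. Any further neighbour in the overlap then contradicts
      \<open>two\<close>.\<close>
    case True
    then obtain y z where yz: "y \<in> ?S" "z \<in> ?S" "y \<noteq> z" "y \<noteq> v" "z \<noteq> v" and "v \<in> ?C"
      using abc by blast
    then obtain u where u: "u \<in> A" "u \<in> set xs" "E v u"
      using v sym by (auto simp: closed_nbhd_def)
    then obtain k where k: "foot u k 1" by (auto simp: foot_def in_set_conv_nth)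
    obtain w where w: "w \<in> ?S" "w \<noteq> v" "w \<noteq> u"
      using yz by blast
    then have "E v w" by (auto simp: closed_nbhd_def)
    obtain j q where "foot w j q" using w(1) foot_exists by blast
    from two[OF u(3) \<open>E v w\<close> w(3)[symmetric] k this] show False by simp
  next
    case False
    then have e: "E v a" "E v b" "E v c" using abc by (auto simp: closed_nbhd_def)
    obtain i p where fa: "foot a i p" using foot_exists abc(1) by blast
    obtain j q where fb: "foot b j q" using foot_exists abc(2) by blast
    obtain k r where fc: "foot c k r" using foot_exists abc(3) by blast
    have "p = 2" "q = 2" "r = 2"
      using two[OF e(1,2) abc(4) fa fb] two[OF e(1,3) abc(5) fa fc] by auto
    \<comment> \<open>The three feet are pairwise at least \<open>length xs - 4 \<ge> 3\<close>
      apart, so the outermost two differ by at least 6, but no two differ by more than 4.\<close>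
    then show False
      using feet_distance[OF v e(1,2) abc(4) fa fb] feet_distance[OF v e(1,3) abc(5) fa fc]
        feet_distance[OF v e(2,3) abc(6) fb fc] l
      by linarith
  qed
qed

end


section \<open>The lower bound for closed neighbourhoods\<close>

lemma (in girth_graph) card_closed_nbhd_ge_if_cycle:
  assumes "A \<subseteq> V" "card A + 2 \<le> g" "7 \<le> g" "g \<le> 10" "2 \<le> d"
    and "\<exists>xs. vertex_cycle (edge_at A) xs"
  shows "card A * (d - 1) + 2 \<le> card (closed_nbhd A)"
proof -
  obtain xs where "vertex_cycle (edge_at A) xs"
    and "\<And>ys. vertex_cycle (edge_at A) ys \<Longrightarrow> length xs \<le> length ys"
    using ex_has_least_nat[of "vertex_cycle (edge_at A)" _ length] assms(6) by blast
  then interpret shortest_cycle_at E V d g A xs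
    using assms by unfold_locales auto
  define B R where "B = A \<inter> set xs" and "R = A - set xs"
  have "finite A" using assms(1) finite_V finite_subset by blast
  have A: "A = R \<union> B" "R \<inter> B = {}" "finite R" "finite B" "B \<subseteq> V" "R \<subseteq> V"
    using \<open>finite A\<close> assms(1) by (auto simp: B_def R_def)
  have card_A: "card A = card R + card B" using A by (metis card_Un_disjoint)
  have base: "card B * (d - 2) + length xs \<le> card (closed_nbhd B)"
    unfolding B_def by (rule card_closed_nbhd_cycle)
  have half: "length xs \<le> 2 * card B" unfolding B_def by (rule length_le_double)
  \<comment> \<open>\<open>card B\<close> is at least \<open>g / 2\<close>, which leaves at most
    \<open>g / 2 - 2\<close> vertices for \<open>R\<close>.\<close>
  have g_R: "2 * card R + 4 \<le> g" using half card_A assms(2) length_ge by linarith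
  have ov: "card (closed_nbhd {v} \<inter> closed_nbhd B) \<le> 2" if "v \<in> R" for v
    using that card_closed_nbhd_Int_cycle[of v] by (auto simp: B_def R_def)
  have pair: "card (closed_nbhd {v} \<inter> closed_nbhd {w}) \<le> 2" if "v \<noteq> w" for v w
    using card_Int_closed_nbhd_le[of v "{w}"] card_nbrs_Int_closed_nbhd_singleton[of v w] that assms(3)
    by simp
  \<comment> \<open>Each vertex of \<open>R\<close> brings at least \<open>d + 1\<close> vertices;
    the successive overlaps sum to at most 2, 2 + 4 and 2 + 3 + 4 for one, two and three
    vertices.\<close>
  have total: "card (closed_nbhd B) + card R * (d + 1) \<le> card (closed_nbhd A) + 3 * card R"
  proof -
    consider "card R = 0" | "card R = 1" | "card R = 2" | "card R = 3"
      using g_R assms(4) by linarith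
    then show ?thesis
    proof cases
      case 1
      then show ?thesis using A by simp
    next
      case 2
      then obtain u where "R = {u}" by (rule card_1_singletonE)
      with card_closed_nbhd_insert[of u B 2] ov A show ?thesis by simp
    next
      case 3
      then obtain u v where R: "R = {u, v}" "u \<noteq> v" by (auto simp: card_2_iff)
      have "card (closed_nbhd {v} \<inter> closed_nbhd (insert u B)) \<le> 4"
        using card_Int_closed_nbhd_insert[of "closed_nbhd {v}" u B] ov[of v] pair[of v u] R by simp
      then have "card (closed_nbhd (insert u B)) + d + 1 \<le> card (closed_nbhd (insert v (insert u B))) + 4"
        using A R by (intro card_closed_nbhd_insert) auto
      moreover have "card (closed_nbhd B) + d + 1 \<le> card (closed_nbhd (insert u B)) + 2"
        using A R ov[of u] by (intro card_closed_nbhd_insert) auto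
      moreover have "A = insert v (insert u B)" using A(1) R by auto
      ultimately show ?thesis using 3 by simp
    next
      case 4
      then obtain u v w where R: "R = {u, v, w}" "u \<noteq> v" "u \<noteq> w" "v \<noteq> w" by (auto simp: card_3_iff)
      \<comment> \<open>Overlaps of two per earlier piece would sum to 12, above the allowed 9. Now
        \<open>g = 10\<close>, so the neighbours of a vertex of \<open>R\<close> meet each earlier
        piece at most once, and the vertex itself adds only one.\<close>
      have "9 \<le> length xs" using g_R 4 length_ge by simp
      then have nb: "card ({y. E x y} \<inter> closed_nbhd B) \<le> 1" if "x \<in> R" for x
        using that card_nbrs_Int_closed_nbhd_cycle[of x] by (auto simp: B_def R_def)
      have nb1: "card ({y. E x y} \<inter> closed_nbhd {z}) \<le> 1" if "x \<noteq> z" for x z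
        using that card_nbrs_Int_closed_nbhd_singleton[of x z] assms(3) by simp
      have v2: "card ({y. E v y} \<inter> closed_nbhd (insert u B)) \<le> 2"
        using card_Int_closed_nbhd_insert[of "{y. E v y}" u B] nb[of v] nb1[of v u] R by simp
      have w2: "card ({y. E w y} \<inter> closed_nbhd (insert u B)) \<le> 2"
        using card_Int_closed_nbhd_insert[of "{y. E w y}" u B] nb[of w] nb1[of w u] R by simp
      have w3: "card ({y. E w y} \<inter> closed_nbhd (insert v (insert u B))) \<le> 3"
        using card_Int_closed_nbhd_insert[of "{y. E w y}" v "insert u B"] w2 nb1[of w v] R by simp
      have out: "v \<notin> insert u B" "w \<notin> insert v (insert u B)" using R A(2) by auto
      have "card (closed_nbhd B) + d + 1 \<le> card (closed_nbhd (insert u B)) + 2"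
        using A R ov[of u] by (intro card_closed_nbhd_insert) auto
      moreover have "card (closed_nbhd (insert u B)) + d + 1
          \<le> card (closed_nbhd (insert v (insert u B))) + 3"
        using A R card_Int_closed_nbhd_le[OF out(1)] v2 by (intro card_closed_nbhd_insert) auto
      moreover have "card (closed_nbhd (insert v (insert u B))) + d + 1
          \<le> card (closed_nbhd (insert w (insert v (insert u B)))) + 4"
        using A R card_Int_closed_nbhd_le[OF out(2)] w3 by (intro card_closed_nbhd_insert) auto
      moreover have "A = insert w (insert v (insert u B))" using A(1) R by auto
      ultimately show ?thesis using 4 by simp
    qed
  qed
  obtain e where d: "d = e + 2" using assms(5) by (metis add.commute le_Suc_ex)
  have "card A * (d - 1) + 2 = card B * e + card R * e + (card A + 2)"
    by (simp add: d card_A algebra_simps)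
  also have "\<dots> \<le> card B * e + card R * e + length xs"
    using assms(2) length_ge by simp
  also have "\<dots> \<le> card (closed_nbhd A)"
    using base total by (simp add: d algebra_simps)
  finally show ?thesis .
qed

lemma (in girth_graph) card_closed_nbhd_ge:
  assumes "A \<subseteq> V" "A \<noteq> {}" "card A + 2 \<le> g" "7 \<le> g" "g \<le> 10" "2 \<le> d"
  shows "card A * (d - 1) + 2 \<le> card (closed_nbhd A)"
  using assms(1-3)
proof (induction "card A" arbitrary: A rule: less_induct)
  case less
  have "finite A" using less.prems(1) finite_V finite_subset by blast
  show ?case
  proof (cases "card A = 1")
    case True
    then obtain v where "A = {v}" by (rule card_1_singletonE)
    then show ?thesis using card_closed_nbhd_singleton[of v] less.prems(1) \<open>2 \<le> d\<close> by simp
  next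
    case False
    show ?thesis
    proof (cases "\<exists>v\<in>A. card (closed_nbhd {v} \<inter> closed_nbhd (A - {v})) \<le> 2")
      case True
      then obtain v where v: "v \<in> A" "card (closed_nbhd {v} \<inter> closed_nbhd (A - {v})) \<le> 2" by blast
      have card: "card A = Suc (card (A - {v}))"
        using v(1) \<open>finite A\<close> by (simp only: card.remove)
      then have "A - {v} \<noteq> {}" using False by (metis card.empty One_nat_def)
      then have "card (A - {v}) * (d - 1) + 2 \<le> card (closed_nbhd (A - {v}))"
        using less.prems card by (intro less.hyps) auto
      \<comment> \<open>The removed vertex accounts for at least \<open>d + 1 - 2\<close> vertices,
        the slope of the bound.\<close>
      moreover have "card (closed_nbhd (A - {v})) + d + 1 \<le> card (closed_nbhd A) + 2"
        using card_closed_nbhd_insert[of v "A - {v}" 2] v less.prems(1)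
        by (auto simp: insert_absorb)
      ultimately show ?thesis using \<open>2 \<le> d\<close> by (simp add: card)
    next
      case no: False
      \<comment> \<open>In the graph of edges meeting \<open>A\<close>, every vertex of this set has two neighbours in it.\<close>
      let ?W = "{y \<in> closed_nbhd A. y \<in> A \<or> (\<forall>u. \<exists>w\<in>A. w \<noteq> u \<and> E y w)}"
      have two: "\<exists>y\<in>?W. y \<noteq> u \<and> edge_at A v y" if "v \<in> A" for u v
      proof -
        let ?S = "closed_nbhd {v} \<inter> closed_nbhd (A - {v})"
        have "\<not> card ?S \<le> 2" using no that by blast
        moreover have "card {u, v} \<le> 2" by (auto simp: card_insert_if)
        ultimately have "\<not> ?S \<subseteq> {u, v}"
          using card_mono[of "{u, v}" ?S] by fastforce
        then obtain y where y: "y \<in> ?S" "y \<noteq> u" "y \<noteq> v" by blast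
        then have "E v y" by (auto simp: closed_nbhd_def)
        \<comment> \<open>Outside \<open>A\<close>, \<open>y\<close> has the two distinct neighbours
          \<open>v\<close> and \<open>w\<close> in \<open>A\<close>, so no single vertex excludes
          both.\<close>
        moreover have "y \<in> ?W"
        proof (cases "y \<in> A")
          case False
          then obtain w where w: "w \<in> A" "w \<noteq> v" "E y w"
            using y(1) sym by (auto simp: closed_nbhd_def)
          have "\<exists>x\<in>A. x \<noteq> z \<and> E y x" for z
            using w that sym[OF \<open>E v y\<close>] by (cases "z = v") auto
          moreover have "y \<in> closed_nbhd A" using that \<open>E v y\<close> by (auto simp: closed_nbhd_def)
          ultimately show ?thesis by blast
        qed (auto simp: closed_nbhd_def)
        ultimately show ?thesis using y(2) that by (auto simp: edge_at_def)
      qed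
      have "\<exists>xs. vertex_cycle (edge_at A) xs"
      proof (rule exists_vertex_cycle[of ?W])
        show "finite ?W" using finite_closed_nbhd[OF less.prems(1)] by simp
        show "?W \<noteq> {}" using less.prems(2) by (auto simp: closed_nbhd_def)
        fix w u assume "w \<in> ?W"
        then show "\<exists>w'\<in>?W. edge_at A w w' \<and> w' \<noteq> u"
        proof (cases "w \<in> A")
          case False
          then obtain w' where "w' \<in> A" "w' \<noteq> u" "E w w'" using \<open>w \<in> ?W\<close> by blast
          then show ?thesis by (auto simp: edge_at_def closed_nbhd_def)
        qed (use two in blast)
      qed (auto simp: edge_at_def irrefl intro: sym)
      with card_closed_nbhd_ge_if_cycle less.prems assms(4-6) show ?thesis by blast
    qed
  qed
qed

section \<open>Forcing\<close>

text \<open>\<open>A\<close> collects the first \<open>t\<close> forcing vertices: each force colors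
  one vertex and completes the closed neighbourhood of the forcing vertex. Quantifying over all
  \<open>t\<close> carries earlier prefixes through the induction.\<close>

lemma forcing_prefix:
  assumes "(force_step G)\<^sup>*\<^sup>* S D" "finite S"
  shows "S \<subseteq> D \<and> finite D \<and> (\<forall>t. card S + t \<le> card D \<longrightarrow>
    (\<exists>A. A \<subseteq> D \<and> card A = t \<and> finite A \<and> A \<union> (\<Union>v\<in>A. nbrs G v) \<subseteq> D
      \<and> card (A \<union> (\<Union>v\<in>A. nbrs G v)) \<le> card S + t))"
  using assms(1)
proof (induction rule: rtranclp_induct)
  case base
  then show ?case using assms(2) by auto
next
  case (step C D)
  from step.hyps(2) obtain v w where D: "v \<in> C" "nbrs G v - C = {w}" "D = insert w C"
    by (cases rule: force_step.cases) auto
  have "w \<notin> C" "w \<in> nbrs G v" using D(2) by auto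
  have C: "S \<subseteq> C" "finite C" using step.IH by auto
  have card_D: "card D = Suc (card C)" using D C \<open>w \<notin> C\<close> by simp
  have "\<exists>A. A \<subseteq> D \<and> card A = t \<and> finite A \<and> A \<union> (\<Union>v\<in>A. nbrs G v) \<subseteq> D
      \<and> card (A \<union> (\<Union>v\<in>A. nbrs G v)) \<le> card S + t" if t: "card S + t \<le> card D" for t
  proof (cases "card S + t \<le> card C")
    case True
    then show ?thesis using step.IH D(3) by (meson subset_insertI subset_trans)
  next
    case False
    \<comment> \<open>The only new value of \<open>t\<close> counts the current force, so
      \<open>v\<close> joins the set for \<open>t - 1\<close>.\<close>
    then have t': "card S + t = Suc (card C)" using t card_D by simp
    moreover have "card S \<le> card C" using C by (simp add: card_mono)
    ultimately obtain t0 where t0: "t = Suc t0" "card S + t0 = card C" by (cases t) auto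
    then obtain A where A: "A \<subseteq> C" "card A = t0" "finite A" "A \<union> (\<Union>v\<in>A. nbrs G v) \<subseteq> C"
      using step.IH by (metis le_refl)
    \<comment> \<open>No vertex forces twice: the neighbours of earlier forcing vertices are already
      in \<open>C\<close>, while \<open>w\<close> is not.\<close>
    have "v \<notin> A" using A(4) \<open>w \<notin> C\<close> \<open>w \<in> nbrs G v\<close> by blast
    have sub: "insert v A \<union> (\<Union>v\<in>insert v A. nbrs G v) \<subseteq> D"
      using A D by auto
    then have "card (insert v A \<union> (\<Union>v\<in>insert v A. nbrs G v)) \<le> card S + t"
      using card_mono[OF _ sub] C(2) D(3) t' card_D by simp
    then show ?thesis
      using sub A(2,3) \<open>v \<notin> A\<close> t0(1) by (intro exI[of _ "insert v A"]) auto
  qed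
  then show ?case using C D(3) by auto
qed

section \<open>From vertex lists to arc walks\<close>

lemma (in wf_digraph) walk_of_vertex_list:
  assumes "successively (\<lambda>x y. x \<rightarrow> y) (x # xs)" "x \<in> verts G"
  shows "\<exists>p. awalk x p (last (x # xs)) \<and> awalk_verts x p = x # xs"
  using assms
proof (induction xs arbitrary: x)
  case Nil
  then show ?case by (intro exI[of _ "[]"]) (simp add: awalk_Nil_iff)
next
  case (Cons y xs)
  then have "x \<rightarrow> y" "y \<in> verts G" by auto
  then obtain e where e: "e \<in> arcs G" "tail G e = x" "head G e = y" by auto
  obtain p where p: "awalk y p (last (y # xs))" "awalk_verts y p = y # xs"
    using Cons.IH[of y] Cons.prems \<open>y \<in> verts G\<close> by auto
  then show ?case
    using e by (intro exI[of _ "e # p"]) (simp add: awalk_Cons_iff)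
qed

lemma (in wf_digraph) undirected_cycle_of_vertex_cycle:
  assumes "vertex_cycle (\<lambda>x y. x \<rightarrow> y) xs"
  shows "\<exists>p. undirected_cycle G p \<and> length p = length xs"
proof -
  have "xs \<noteq> []" using assms by (auto simp: vertex_cycle_def)
  have "last xs \<rightarrow> hd xs" using assms by (simp add: vertex_cycle_def)
  then have "last xs \<in> verts G" by (rule adj_in_verts(1))
  \<comment> \<open>Starting the closed walk at \<open>last xs\<close> makes \<open>xs\<close> the
    tail of its vertex sequence, the list that \<open>cycle\<close> requires to be distinct.\<close>
  have "successively (\<lambda>x y. x \<rightarrow> y) (last xs # xs)"
    using assms \<open>last xs \<rightarrow> hd xs\<close> by (auto simp: vertex_cycle_def successively_Cons)
  from walk_of_vertex_list[OF this \<open>last xs \<in> verts G\<close>] obtain p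
    where p: "awalk (last xs) p (last xs)" "awalk_verts (last xs) p = last xs # xs"
    using \<open>xs \<noteq> []\<close> by auto
  have "length (awalk_verts (last xs) p) = Suc (length p)" by (rule length_awalk_verts)
  then have len: "length p = length xs" using p(2) by simp
  moreover have "cycle p"
    unfolding cycle_def using p assms len \<open>xs \<noteq> []\<close>
    by (intro exI[of _ "last xs"]) (auto simp: vertex_cycle_def)
  ultimately show ?thesis using assms by (auto simp: undirected_cycle_def vertex_cycle_def)
qed

lemma (in graph) girth_graph_dominates:
  assumes "girth G = enat g"
  shows "girth_graph (\<lambda>x y. x \<rightarrow> y) (verts G) (min_degree G) g"
proof
  show "finite (verts G)" by simp
  show "y \<rightarrow> x" if "x \<rightarrow> y" for x y using that sym_arcs by (auto simp: symmetric_def dest: symD)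
  show "\<not> x \<rightarrow> x" for x using no_loops by (auto simp: arcs_ends_def arc_to_ends_def)
  show "y \<in> verts G" if "x \<rightarrow> y" for x y using that by auto
  show "min_degree G \<le> card {w. v \<rightarrow> w}" if "v \<in> verts G" for v
    using that by (auto simp: min_degree_def graph_out_degree_eq nbrs_def intro!: Min_le)
  show "g \<le> length xs" if cyc: "vertex_cycle (\<lambda>x y. x \<rightarrow> y) xs" for xs
  proof -
    obtain p where "undirected_cycle G p" "length p = length xs"
      using undirected_cycle_of_vertex_cycle[OF cyc] by blast
    then have "girth G \<le> enat (length xs)"
      unfolding girth_def by (metis (mono_tags, lifting) INF_lower mem_Collect_eq)
    then show ?thesis using assms by simp
  qed
qed

lemma (in graph) verts_nonempty_if_girth:
  assumes "girth G = enat g"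
  shows "verts G \<noteq> {}"
proof
  assume "verts G = {}"
  then have "{p. undirected_cycle G p} = {}"
    by (auto simp: undirected_cycle_def cycle_def awalk_def)
  then show False using assms by (simp add: girth_def top_enat_def)
qed

theorem theorem3:
  fixes G :: "('a, 'b) pre_digraph" and g :: nat
  assumes "graph G"
    and "girth G = enat g"
    and "g \<in> {7, 8, 9, 10}"
    and "min_degree G \<ge> 2"
  shows "int (forcing_number G) \<ge>
    int (min_degree G) + (int (min_degree G) - 2) * (int g - 3)"
proof -
  interpret graph G by (rule assms(1))
  interpret girth_graph "\<lambda>x y. x \<rightarrow>\<^bsub>G\<^esub> y" "verts G" "min_degree G" g
    by (rule girth_graph_dominates[OF assms(2)])
  have g: "7 \<le> g" "g \<le> 10" using assms(3) by auto
  have nbhd: "A \<union> (\<Union>v\<in>A. nbrs G v) = closed_nbhd A" for A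
    by (auto simp: closed_nbhd_def nbrs_def)
  \<comment> \<open>The largest size allowed by \<open>card_closed_nbhd_ge\<close>. The result
    \<open>(g - 2) * (\<delta> - 1) + 2 - (g - 2)\<close> equals
    \<open>\<delta> + (\<delta> - 2) * (g - 3)\<close>.\<close>
  define t where "t = g - 2"
  have t: "0 < t" "t + 2 \<le> g" using g by (auto simp: t_def)
  have "forcing_number G \<in> card ` {S. forcing_set G S}"
    unfolding forcing_number_def using finite_forcing_sets forcing_set_verts
    by (intro Min_in) auto
  then obtain S where S: "forcing_number G = card S" "S \<subseteq> verts G" "(force_step G)\<^sup>*\<^sup>* S (verts G)"
    by (auto simp: forcing_set_def)
  have "finite S" using S(2) finite_verts finite_subset by blast
  have "t * (min_degree G - 1) + 2 \<le> card S + t"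
  proof (cases "card S + t \<le> card (verts G)")
    case True
    then obtain A where A: "A \<subseteq> verts G" "card A = t" "card (closed_nbhd A) \<le> card S + t"
      using forcing_prefix[OF S(3) \<open>finite S\<close>] unfolding nbhd by blast
    have "A \<noteq> {}" using A(2) t(1) by auto
    then show ?thesis
      using card_closed_nbhd_ge[of A] A t g assms(4) by simp
  next
    case False
    \<comment> \<open>With fewer than \<open>t\<close> vertices, the bound would apply to
      \<open>verts G\<close> itself, whose closed neighbourhood cannot be larger than
      itself.\<close>
    have "\<exists>A\<subseteq>verts G. card A = t"
    proof (rule ccontr)
      assume "\<not> ?thesis"
      then have "card (verts G) < t"
        by (meson not_le obtain_subset_with_card_n)
      then have "card (verts G) * (min_degree G - 1) + 2 \<le> card (closed_nbhd (verts G))"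
        using t g assms(4) verts_nonempty_if_girth[OF assms(2)] by (intro card_closed_nbhd_ge) auto
      also have "\<dots> \<le> card (verts G)"
        by (intro card_mono closed_nbhd_subset_V) auto
      also have "\<dots> \<le> card (verts G) * (min_degree G - 1)"
        using le_Suc_ex[OF assms(4)] by auto
      finally show False by simp
    qed
    then obtain A where A: "A \<subseteq> verts G" "card A = t" by blast
    then have "A \<noteq> {}" using t(1) by auto
    then have "t * (min_degree G - 1) + 2 \<le> card (closed_nbhd A)"
      using card_closed_nbhd_ge[of A] A t g assms(4) by simp
    also have "\<dots> \<le> card (verts G)"
      using A(1) by (intro card_mono closed_nbhd_subset_V) auto
    finally show ?thesis using False by simp
  qed
  then have "int (t * (min_degree G - 1) + 2) \<le> int (card S + t)" by (simp only: of_nat_le_iff)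
  moreover have "int t = int g - 2" using g by (simp add: t_def of_nat_diff)
  moreover have "int (min_degree G - 1) = int (min_degree G) - 1" using assms(4) by (simp add: of_nat_diff)
  ultimately have "(int g - 2) * (int (min_degree G) - 1) + 2 \<le> int (card S) + (int g - 2)" by simp
  then show ?thesis unfolding S(1) by (simp add: algebra_simps)
qed

end
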